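(* Let $p$ be an odd prime and $N_{p-2}$ the number of permutations of $p-2$ letters with an even number of ascents. If $p$ is both a Wilson prime and a super Wieferich prime, then $(2N_{p-2})_0=(2N_{p-2})_1=1$.
   Context: A Wilson prime is a prime $p$ with $(p-1)!\equiv-1\pmod{p^2}$. A super Wieferich prime is a prime $p$ with $\frac{2^{p-1}-1}{p}\equiv0\pmod{p^2}$. For a $p$-adic integer $x$, write $x=\sum_{j\ge0}(x)_jp^j$ with digits $(x)_j\in\{0,\dots,p-1\}$. For a permutation $(i_1,\dots,i_n)$ of $\{1,\dots,n\}$, an ascent is an index $k$ with $i_{k+1}>i_k$. *)

theory Defs
  imports "HOL-Number_Theory.Number_Theory" "HOL-Combinatorics.Permutations"
begin

definition wilson_prime :: "nat \<Rightarrow> bool" where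
  "wilson_prime p \<longleftrightarrow> prime p \<and> [(fact (p - 1) :: int) = - 1] (mod (int p)\<^sup>2)"

(* The divisibility conjunct says that the Fermat quotient is an integer. It is automatic for odd
   primes, but fails for p = 2, where the truncating div would yield 0. *)
definition super_wieferich_prime :: "nat \<Rightarrow> bool" where
  "super_wieferich_prime p \<longleftrightarrow> prime p \<and> int p dvd 2 ^ (p - 1) - 1 \<and>
     [(2 ^ (p - 1) - 1) div int p = 0] (mod (int p)\<^sup>2)"

(* A permutation (i_1, ..., i_n) is represented by the function k |-> i_k. *)
definition ascents :: "nat \<Rightarrow> (nat \<Rightarrow> nat) \<Rightarrow> nat set" where
  "ascents n i = {k \<in> {1..<n}. i (k + 1) > i k}"

definition num_even_ascents :: "nat \<Rightarrow> nat" where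
  "num_even_ascents n = card {i. i permutes {1..n} \<and> even (card (ascents n i))}"

(* The series of the d j * p^j converges p-adically to x, with digits in {0, ..., p - 1}.
   Only p-adic integers x that are rational integers are covered. *)
definition is_padic_expansion :: "nat \<Rightarrow> int \<Rightarrow> (nat \<Rightarrow> nat) \<Rightarrow> bool" where
  "is_padic_expansion p x d \<longleftrightarrow> (\<forall>j. d j \<in> {0..p - 1}) \<and>
     (\<forall>m. \<forall>\<^sub>F n in sequentially. [(\<Sum>j<n. int (d j) * int p ^ j) = x] (mod int p ^ m))"

definition padic_digit :: "nat \<Rightarrow> int \<Rightarrow> nat \<Rightarrow> nat" where
  "padic_digit p x = (THE d. is_padic_expansion p x d)"

lemma padic_partial_sum_cong:
  fixes d :: "nat \<Rightarrow> nat"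
  assumes "m \<le> n"
  shows "[(\<Sum>j<n. int (d j) * int p ^ j) = (\<Sum>j<m. int (d j) * int p ^ j)] (mod int p ^ m)"
  using assms
proof (induction n rule: dec_induct)
  case (step n)
  have "[int (d n) * int p ^ n = 0] (mod int p ^ m)"
    using step.hyps by (simp add: cong_0_iff le_imp_power_dvd)
  from cong_add[OF step.IH this] show ?case by simp
qed simp

lemma is_padic_expansion_cong:
  assumes "is_padic_expansion p x d"
  shows "[(\<Sum>j<m. int (d j) * int p ^ j) = x] (mod int p ^ m)"
proof -
  have "\<forall>\<^sub>F n in sequentially. n \<ge> m \<and> [(\<Sum>j<n. int (d j) * int p ^ j) = x] (mod int p ^ m)"
    using assms by (auto simp: is_padic_expansion_def eventually_ge_at_top intro: eventually_conj)
  then obtain n where n: "n \<ge> m" "[(\<Sum>j<n. int (d j) * int p ^ j) = x] (mod int p ^ m)"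
    using eventually_happens'[OF sequentially_bot] by blast
  then show ?thesis
    using padic_partial_sum_cong[OF n(1)] cong_sym cong_trans by blast
qed

lemma is_padic_expansion_unique:
  assumes "is_padic_expansion p x d" "is_padic_expansion p x e" "p > 0"
  shows "d = e"
proof
  fix j show "d j = e j"
  proof (induction j rule: less_induct)
    case (less j)
    have "[(\<Sum>k<Suc j. int (d k) * int p ^ k) = (\<Sum>k<Suc j. int (e k) * int p ^ k)]
            (mod int p ^ Suc j)"
      using is_padic_expansion_cong[OF assms(1)] is_padic_expansion_cong[OF assms(2)]
        cong_sym cong_trans by blast
    moreover have "(\<Sum>k<j. int (d k) * int p ^ k) = (\<Sum>k<j. int (e k) * int p ^ k)"
      using less by simp
    ultimately have "[int (d j) * int p ^ j = int (e j) * int p ^ j] (mod int p ^ Suc j)"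
      by (simp add: cong_add_lcancel)
    then have "int p ^ j * int p dvd int p ^ j * (int (d j) - int (e j))"
      by (simp add: cong_iff_dvd_diff algebra_simps)
    then have "[int (d j) = int (e j)] (mod int p)"
      using \<open>p > 0\<close> by (simp add: cong_iff_dvd_diff)
    then have "[d j = e j] (mod p)"
      by (simp add: cong_int_iff)
    moreover have "d j \<le> p - 1" "e j \<le> p - 1"
      using assms by (auto simp: is_padic_expansion_def)
    then have "d j < p" "e j < p"
      using \<open>p > 0\<close> by linarith+
    ultimately show ?case
      by (simp add: cong_less_modulus_unique_nat)
  qed
qed

lemma is_padic_expansion_div_mod:
  assumes "p > 0"
  shows "is_padic_expansion p x (\<lambda>j. nat (x div int p ^ j mod int p))"
proof -
  let ?d = "\<lambda>j. nat (x div int p ^ j mod int p)"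
  have sum: "(\<Sum>j<n. int (?d j) * int p ^ j) = x mod int p ^ n" for n
  proof (induction n)
    case (Suc n)
    have "x mod (int p ^ n * int p) = int p ^ n * (x div int p ^ n mod int p) + x mod int p ^ n"
      using assms by (intro zmod_zmult2_eq) simp
    with Suc show ?case using assms by (simp add: mult.commute)
  qed simp
  have "?d j \<le> p - 1" for j
  proof -
    have "x div int p ^ j mod int p < int p" using assms by simp
    then show ?thesis using assms by linarith
  qed
  moreover have "\<forall>\<^sub>F n in sequentially. [(\<Sum>j<n. int (?d j) * int p ^ j) = x] (mod int p ^ m)" for m
    using eventually_ge_at_top[of m]
  proof eventually_elim
    case (elim n)
    then show ?case unfolding sum
      by (simp add: cong_def mod_mod_cancel le_imp_power_dvd)
  qed
  ultimately show ?thesis by (simp add: is_padic_expansion_def)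
qed

lemma padic_digit_eq:
  assumes "p > 0"
  shows "padic_digit p x j = nat (x div int p ^ j mod int p)"
  using the_equality[where P = "is_padic_expansion p x", OF is_padic_expansion_div_mod[OF assms]]
    is_padic_expansion_unique[OF _ is_padic_expansion_div_mod[OF assms] assms]
  unfolding padic_digit_def by metis

end

theory Submission
  imports Defs "HOL-Combinatorics.Multiset_Permutations"
begin

text \<open>Let \<open>S n\<close> be the sum of \<open>(-1) ^ asc\<close> over all permutations of \<open>n\<close> letters, so that
  \<open>2 * N = n! + S n\<close>. Writing \<open>x = 1 + (x - 1)\<close> at each ascent and splitting off the first block of
  glued letters gives \<open>S n = (\<Sum>k = 1..n. (n choose k) * (-2) ^ (k - 1) * S (n - k))\<close>.
  For odd \<open>M\<close> the numbers \<open>(-2) ^ n * T n\<close> with \<open>T n = (\<Sum>m<M. (-1) ^ m * m ^ n)\<close> satisfy the same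
  recursion modulo \<open>M\<close> by telescoping, hence \<open>S n\<close> is congruent to \<open>(-2) ^ n * T n\<close>.
  For \<open>M = p\<^sup>2\<close> and \<open>n = p - 2\<close>, a congruence of Voronoi type expresses \<open>T n\<close> by
  \<open>(2 ^ (p - 1) - 1) * (\<Sum>m<M. m ^ (p - 1)) / M\<close>, and the super Wieferich condition makes this
  vanish modulo \<open>p\<^sup>2\<close>. Finally Wilson's condition turns \<open>(p - 2)!\<close> into \<open>1 + p\<close>.\<close>

section \<open>Permutations as lists and their ascents\<close>

fun list_ascents :: "'a::linorder list \<Rightarrow> nat" where
  "list_ascents (x # y # zs) = of_bool (x < y) + list_ascents (y # zs)"
| "list_ascents _ = 0"

lemma list_ascents_conv_sum:
  "list_ascents xs = (\<Sum>k<length xs - 1. of_bool (xs ! k < xs ! Suc k))"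
  by (induction xs rule: list_ascents.induct) (simp_all add: sum.lessThan_Suc_shift del: sum.lessThan_Suc)

lemma card_ascents_eq: "card (ascents n i) = list_ascents (map i [1..<n + 1])"
proof -
  have "card (ascents n i) = (\<Sum>k\<in>{1..<n}. of_bool (i k < i (k + 1)))"
    unfolding ascents_def card_eq_sum of_bool_def by (simp only: sum.inter_filter finite_atLeastLessThan)
  \<comment> \<open>Positions of the permutation start at 1, positions in a list at 0.\<close>
  also have "\<dots> = (\<Sum>k<n - 1. of_bool (i (Suc k) < i (Suc (Suc k))))"
    by (rule sum.reindex_bij_witness[of _ Suc "\<lambda>k. k - 1"]) auto
  also have "\<dots> = list_ascents (map i [1..<n + 1])"
    unfolding list_ascents_conv_sum by (rule sum.cong) (auto simp: nth_upt simp del: upt_Suc)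
  finally show ?thesis .
qed

text \<open>A permutation is the identity outside \<open>set xs\<close>, so its values along
  \<open>xs\<close> determine it. Surjectivity comes from counting: both sides have
  \<open>fact (card (set xs))\<close> elements.\<close>

lemma bij_betw_permutes_permutations_of_set:
  assumes "distinct xs"
  shows "bij_betw (\<lambda>f. map f xs) {f. f permutes set xs} (permutations_of_set (set xs))"
proof -
  have inj: "inj_on (\<lambda>f. map f xs) {f. f permutes set xs}"
    by (rule inj_onI) (auto simp: fun_eq_iff permutes_def)
  have "(\<lambda>f. map f xs) ` {f. f permutes set xs} = permutations_of_set (set xs)"
  proof (rule card_subset_eq)
    show "(\<lambda>f. map f xs) ` {f. f permutes set xs} \<subseteq> permutations_of_set (set xs)"
      using assms by (auto simp: permutes_image distinct_map permutes_inj_on intro!: permutations_of_setI)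
    show "card ((\<lambda>f. map f xs) ` {f. f permutes set xs}) = card (permutations_of_set (set xs))"
      by (simp add: card_image[OF inj] card_permutations[OF refl])
  qed simp
  with inj show ?thesis by (simp add: bij_betw_def)
qed

section \<open>Eulerian polynomials and the recursion by glued blocks\<close>

text \<open>For finite \<open>A\<close> this is the Eulerian polynomial of degree index
  \<open>card A\<close> at \<open>x\<close>. Indexing by sets instead of sizes avoids relabelling
  when letters are removed.\<close>

definition ascent_sum :: "'b::comm_ring_1 \<Rightarrow> 'a::linorder set \<Rightarrow> 'b" where
  "ascent_sum x A = (\<Sum>xs\<in>permutations_of_set A. x ^ list_ascents xs)"

definition ascent_sum_from :: "'b::comm_ring_1 \<Rightarrow> 'a::linorder \<Rightarrow> 'a set \<Rightarrow> 'b" where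
  "ascent_sum_from x a A = (\<Sum>xs\<in>permutations_of_set A. x ^ list_ascents (a # xs))"

lemma sum_permutations_of_set_Cons:
  assumes "finite A" "A \<noteq> {}"
  shows "(\<Sum>xs\<in>permutations_of_set A. f xs) =
           (\<Sum>b\<in>A. \<Sum>xs\<in>permutations_of_set (A - {b}). f (b # xs))"
  unfolding permutations_of_set_nonempty[OF assms(2)] using assms(1)
  by (subst sum.UNION_disjoint) (auto simp: sum.reindex)

lemma ascent_sum_conv_from:
  assumes "finite A" "A \<noteq> {}"
  shows "ascent_sum x A = (\<Sum>b\<in>A. ascent_sum_from x b (A - {b}))"
  unfolding ascent_sum_def ascent_sum_from_def by (rule sum_permutations_of_set_Cons[OF assms])

text \<open>The weight \<open>x\<close> of an ascent from \<open>a\<close> to the first letter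
  \<open>b\<close> is split as \<open>1 + (x - 1)\<close>. The summand 1 forgets \<open>a\<close>;
  the summand \<open>x - 1\<close> glues \<open>b\<close> to \<open>a\<close> and survives only for
  \<open>a < b\<close>.\<close>

lemma ascent_sum_from_step:
  fixes x :: "'b::comm_ring_1"
  assumes "finite A"
  shows "ascent_sum_from x a A =
           ascent_sum x A + (x - 1) * (\<Sum>b\<in>{b\<in>A. a < b}. ascent_sum_from x b (A - {b}))"
proof (cases "A = {}")
  case False
  have "ascent_sum_from x a A = (\<Sum>b\<in>A. (if a < b then x else 1) * ascent_sum_from x b (A - {b}))"
    unfolding ascent_sum_from_def sum_permutations_of_set_Cons[OF assms False] sum_distrib_left
    by (intro sum.cong refl) simp
  also have "\<dots> = (\<Sum>b\<in>A. ascent_sum_from x b (A - {b}) +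
      (if a < b then (x - 1) * ascent_sum_from x b (A - {b}) else 0))"
    by (intro sum.cong refl) (simp add: algebra_simps)
  also have "\<dots> = ascent_sum x A + (x - 1) * (\<Sum>b\<in>{b\<in>A. a < b}. ascent_sum_from x b (A - {b}))"
    using assms by (simp add: sum.distrib ascent_sum_conv_from[OF assms False] sum_distrib_left
        flip: sum.inter_filter)
  finally show ?thesis .
qed (simp add: ascent_sum_def ascent_sum_from_def)

text \<open>A nonempty finite set is determined by its minimum \<open>b\<close> and the remaining
  elements, all above \<open>b\<close>.\<close>

lemma sum_nonempty_subsets_by_Min:
  fixes C :: "'a::linorder set"
  assumes "finite C"
  shows "(\<Sum>B\<in>Pow C - {{}}. g B) = (\<Sum>b\<in>C. \<Sum>B\<in>Pow {c\<in>C. b < c}. g (insert b B))"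
proof -
  have "(\<Sum>b\<in>C. \<Sum>B\<in>Pow {c\<in>C. b < c}. g (insert b B)) =
      (\<Sum>(b, B)\<in>Sigma C (\<lambda>b. Pow {c\<in>C. b < c}). g (insert b B))"
    using assms by (subst sum.Sigma) auto
  also have "\<dots> = (\<Sum>B\<in>Pow C - {{}}. g B)"
  proof (rule sum.reindex_bij_witness[of _ "\<lambda>B. (Min B, B - {Min B})" "\<lambda>(b, B). insert b B"])
    fix z assume z: "z \<in> Sigma C (\<lambda>b. Pow {c\<in>C. b < c})"
    obtain b B where zb: "z = (b, B)" by (cases z)
    have B: "b \<in> C" "B \<subseteq> {c\<in>C. b < c}" using z zb by auto
    have "finite B" using B(2) assms by (auto intro: finite_subset)
    then have "Min (insert b B) = b" using B by (intro Min_eqI) auto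
    then show "(Min (case z of (b, B) \<Rightarrow> insert b B),
        (case z of (b, B) \<Rightarrow> insert b B) - {Min (case z of (b, B) \<Rightarrow> insert b B)}) = z"
      using B zb by auto
    show "(case z of (b, B) \<Rightarrow> insert b B) \<in> Pow C - {{}}" using B zb by auto
  next
    fix B assume "B \<in> Pow C - {{}}"
    then have B: "B \<subseteq> C" "B \<noteq> {}" "finite B" using assms by (auto intro: finite_subset)
    have "Min B \<in> B" using B by simp
    moreover have "Min B < c" if "c \<in> B" "c \<noteq> Min B" for c
      using that B by (metis Min_le order_le_neq_trans)
    ultimately show "(Min B, B - {Min B}) \<in> Sigma C (\<lambda>b. Pow {c\<in>C. b < c})"
      using B(1) by blast
    show "(case (Min B, B - {Min B}) of (b, B) \<Rightarrow> insert b B) = B"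
      using \<open>Min B \<in> B\<close> by (simp add: insert_absorb)
  qed auto
  finally show ?thesis ..
qed

text \<open>Iterating the single step: \<open>B\<close> collects the letters glued in increasing
  order behind \<open>a\<close>, each at the cost of a factor \<open>x - 1\<close>, and the letters
  of \<open>A - B\<close> follow freely.\<close>

lemma ascent_sum_from_eq:
  fixes x :: "'b::comm_ring_1" and A :: "'a::linorder set"
  assumes "finite A"
  shows "ascent_sum_from x a A =
           (\<Sum>B\<in>Pow {b\<in>A. a < b}. (x - 1) ^ card B * ascent_sum x (A - B))"
  using assms
proof (induction "card A" arbitrary: a A rule: less_induct)
  case less
  let ?C = "{b\<in>A. a < b}"
  let ?g = "\<lambda>B. (x - 1) ^ card B * ascent_sum x (A - B)"
  have fin: "finite ?C" using less.prems by simp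
  have "ascent_sum_from x b (A - {b}) * (x - 1) = (\<Sum>B\<in>Pow {c\<in>?C. b < c}. ?g (insert b B))"
    if "b \<in> ?C" for b
  proof -
    \<comment> \<open>The condition \<open>a < c\<close> hidden in \<open>?C\<close> follows from
      \<open>a < b\<close> and \<open>b < c\<close>.\<close>
    have eq: "{c \<in> A - {b}. b < c} = {c\<in>?C. b < c}" using that by auto
    have "card (A - {b}) < card A" using less.prems that by (intro psubset_card_mono) auto
    then have "ascent_sum_from x b (A - {b}) =
        (\<Sum>B\<in>Pow {c\<in>?C. b < c}. (x - 1) ^ card B * ascent_sum x (A - {b} - B))"
      using less.hyps[of "A - {b}" b] less.prems eq by simp
    moreover have "?g (insert b B) = (x - 1) ^ card B * ascent_sum x (A - {b} - B) * (x - 1)"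
      if "B \<in> Pow {c\<in>?C. b < c}" for B
    proof -
      have "b \<notin> B" "finite B" using that finite_subset[OF _ fin, of B] by auto
      moreover have "A - {b} - B = A - insert b B" by auto
      ultimately show ?thesis by (simp add: mult_ac)
    qed
    ultimately show ?thesis by (simp add: sum_distrib_right)
  qed
  then have "(x - 1) * (\<Sum>b\<in>?C. ascent_sum_from x b (A - {b})) = (\<Sum>B\<in>Pow ?C - {{}}. ?g B)"
    by (simp add: sum_nonempty_subsets_by_Min[OF fin] sum_distrib_left mult.commute[of "x - 1"])
  then have "ascent_sum_from x a A = ?g {} + (\<Sum>B\<in>Pow ?C - {{}}. ?g B)"
    by (simp add: ascent_sum_from_step[OF less.prems])
  also have "\<dots> = (\<Sum>B\<in>Pow ?C. ?g B)"
    using fin by (subst sum.remove[of "Pow ?C" "{}"]) auto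
  finally show ?case .
qed

text \<open>Here \<open>B\<close> is the first glued block. Its minimum is the first letter of the
  list, and only the other \<open>card B - 1\<close> letters contribute a factor
  \<open>x - 1\<close>.\<close>

lemma ascent_sum_recursion:
  fixes x :: "'b::comm_ring_1" and A :: "'a::linorder set"
  assumes "finite A" "A \<noteq> {}"
  shows "ascent_sum x A = (\<Sum>B\<in>Pow A - {{}}. (x - 1) ^ (card B - 1) * ascent_sum x (A - B))"
  unfolding sum_nonempty_subsets_by_Min[OF assms(1)] ascent_sum_conv_from[OF assms]
proof (intro sum.cong refl)
  fix b assume b: "b \<in> A"
  have eq: "{c \<in> A - {b}. b < c} = {c\<in>A. b < c}" using b by auto
  have "ascent_sum_from x b (A - {b}) =
      (\<Sum>B\<in>Pow {c\<in>A. b < c}. (x - 1) ^ card B * ascent_sum x (A - {b} - B))"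
    using assms eq by (simp add: ascent_sum_from_eq)
  also have "\<dots> = (\<Sum>B\<in>Pow {c\<in>A. b < c}.
      (x - 1) ^ (card (insert b B) - 1) * ascent_sum x (A - insert b B))"
  proof (intro sum.cong refl)
    fix B assume "B \<in> Pow {c\<in>A. b < c}"
    then have "b \<notin> B" "finite B" using assms by (auto intro: finite_subset)
    moreover have "A - {b} - B = A - insert b B" by auto
    ultimately show "(x - 1) ^ card B * ascent_sum x (A - {b} - B) =
        (x - 1) ^ (card (insert b B) - 1) * ascent_sum x (A - insert b B)" by simp
  qed
  finally show "ascent_sum_from x b (A - {b}) = \<dots>" .
qed

text \<open>Twice the indicator of an even number of ascents is \<open>1 + (-1) ^ asc\<close>, with
  \<open>asc\<close> the number of ascents.\<close>

lemma two_times_num_even_ascents: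
  "2 * int (num_even_ascents n) = fact n + ascent_sum (-1) {1..n}"
proof -
  let ?P = "{i. i permutes {1..n}}"
  have fin: "finite ?P" by (simp add: finite_permutations)
  have bij: "bij_betw (\<lambda>f. map f [1..<n + 1]) ?P (permutations_of_set {1..n})"
    using bij_betw_permutes_permutations_of_set[of "[1..<n + 1]"]
    by (simp add: atLeastLessThanSuc_atLeastAtMost del: upt_Suc)
  have "2 * int (num_even_ascents n) = (\<Sum>i\<in>?P. if even (card (ascents n i)) then 2 else 0)"
    using sum.inter_filter[OF fin, of "\<lambda>_. 2::int" "\<lambda>i. even (card (ascents n i))"]
    by (simp add: num_even_ascents_def)
  also have "\<dots> = (\<Sum>i\<in>?P. 1 + (-1) ^ card (ascents n i))"
    by (intro sum.cong) auto
  also have "\<dots> = int (card ?P) + (\<Sum>i\<in>?P. (-1) ^ list_ascents (map i [1..<n + 1]))"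
    by (simp add: sum.distrib card_ascents_eq del: upt_Suc)
  also have "(\<Sum>i\<in>?P. (-1) ^ list_ascents (map i [1..<n + 1])) = (ascent_sum (-1) {1..n} :: int)"
    unfolding ascent_sum_def using sum.reindex_bij_betw[OF bij] .
  also have "card ?P = fact n" by (simp add: card_permutations)
  finally show ?thesis by simp
qed

section \<open>Alternating power sums\<close>

definition alt_power_sum :: "nat \<Rightarrow> nat \<Rightarrow> int" where
  "alt_power_sum M n = (\<Sum>m<M. (-1) ^ m * int m ^ n)"

lemma sum_Pow_card:
  assumes "finite A"
  shows "(\<Sum>B\<in>Pow A. f (card B)) = (\<Sum>k\<le>card A. of_nat (card A choose k) * f k)"
proof -
  have "(\<Sum>B\<in>Pow A. f (card B)) = (\<Sum>k\<le>card A. \<Sum>B | B \<in> Pow A \<and> card B = k. f (card B))"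
    by (rule sum.group[symmetric]) (use assms in \<open>auto intro: card_mono\<close>)
  also have "\<dots> = (\<Sum>k\<le>card A. of_nat (card A choose k) * f k)"
  proof (intro sum.cong refl)
    fix k
    have "(\<Sum>B | B \<in> Pow A \<and> card B = k. f (card B)) = (\<Sum>B | B \<subseteq> A \<and> card B = k. f k)"
      by (rule sum.cong) auto
    then show "(\<Sum>B | B \<in> Pow A \<and> card B = k. f (card B)) = of_nat (card A choose k) * f k"
      using n_subsets[OF assms] by simp
  qed
  finally show ?thesis .
qed

text \<open>By the binomial theorem the sum over \<open>k\<close> shifts \<open>m\<close> to
  \<open>m + 1\<close>, and adding the unshifted sum telescopes. The boundary term is
  \<open>+ int M ^ n\<close> because \<open>M\<close> is odd.\<close>

lemma alt_power_sum_recursion: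
  assumes "odd M"
  shows "alt_power_sum M n + (\<Sum>k\<le>n. int (n choose k) * alt_power_sum M (n - k)) = 0 ^ n + int M ^ n"
proof -
  have "(\<Sum>k\<le>n. int (n choose k) * alt_power_sum M (n - k)) =
      (\<Sum>m<M. (-1) ^ m * (\<Sum>k\<le>n. int (n choose k) * int m ^ (n - k)))"
    unfolding alt_power_sum_def sum_distrib_left
    by (subst sum.swap) (simp add: mult_ac)
  also have "\<dots> = (\<Sum>m<M. (-1) ^ m * (1 + int m) ^ n)"
    by (simp add: binomial_ring)
  also have "alt_power_sum M n + \<dots> = (\<Sum>m<M. (-1) ^ m * int m ^ n - (-1) ^ Suc m * int (Suc m) ^ n)"
    by (simp add: alt_power_sum_def sum.distrib)
  also have "\<dots> = 0 ^ n + int M ^ n"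
    using sum_lessThan_telescope'[of "\<lambda>m. (-1) ^ m * int m ^ n" M] assms by simp
  finally show ?thesis by simp
qed

lemma sum_even_odd_split:
  fixes f :: "nat \<Rightarrow> 'a::comm_monoid_add"
  shows "(\<Sum>m<2 * h + 1. f m) = (\<Sum>t\<le>h. f (2 * t)) + (\<Sum>t<h. f (2 * t + 1))"
  by (induction h) (simp_all add: ac_simps)

lemma alt_power_sum_odd:
  "alt_power_sum (2 * h + 1) n = (\<Sum>m<2 * h + 1. int m ^ n) - 2 * (\<Sum>t<h. int (2 * t + 1) ^ n)"
  unfolding alt_power_sum_def sum_even_odd_split by (simp add: sum_negf)

section \<open>Divisibility of power sums and a Voronoi congruence\<close>

text \<open>The terms for \<open>m\<close> and \<open>M - m\<close> cancel modulo \<open>M\<close>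
  since \<open>n\<close> is odd. This pairing yields twice the sum, and 2 is invertible modulo
  \<open>M\<close>.\<close>

lemma dvd_power_sum_odd:
  assumes "odd M" "odd n"
  shows "int M dvd (\<Sum>m<M. int m ^ n)"
proof -
  have "M > 0" "n > 0" using assms by (auto elim: oddE)
  then have "(\<Sum>m<M. int m ^ n) = (\<Sum>m\<in>{1..<M}. int m ^ n)"
    by (intro sum.mono_neutral_right) auto
  moreover have "(\<Sum>m\<in>{1..<M}. int m ^ n) = (\<Sum>m\<in>{1..<M}. (int M - int m) ^ n)"
    by (rule sum.reindex_bij_witness[of _ "\<lambda>m. M - m" "\<lambda>m. M - m"]) auto
  ultimately have "2 * (\<Sum>m<M. int m ^ n) = (\<Sum>m\<in>{1..<M}. int m ^ n + (int M - int m) ^ n)"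
    by (simp add: sum.distrib)
  also have "int M dvd \<dots>"
  proof (rule dvd_sum)
    fix m
    have "[(int M - int m) ^ n = (- int m) ^ n] (mod int M)"
      by (intro cong_pow) (simp add: cong_iff_dvd_diff)
    then show "int M dvd int m ^ n + (int M - int m) ^ n"
      using assms by (simp add: cong_iff_dvd_diff add.commute)
  qed
  finally have "int M dvd 2 * (\<Sum>m<M. int m ^ n)" .
  moreover have "coprime (int M) 2" using assms by simp
  ultimately show ?thesis by (simp add: coprime_dvd_mult_right_iff)
qed

text \<open>First-order binomial expansion; the exponent \<open>Suc n\<close> avoids a truncated
  \<open>n - 1\<close> in the derivative.\<close>

lemma cong_power_add_square:
  fixes x M :: int
  shows "[(x + M) ^ Suc n = x ^ Suc n + int (Suc n) * x ^ n * M] (mod M ^ 2)"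
proof (induction n)
  case (Suc n)
  have "[(x + M) * (x + M) ^ Suc n = (x + M) * (x ^ Suc n + int (Suc n) * x ^ n * M)] (mod M ^ 2)"
    by (rule cong_mult[OF cong_refl Suc.IH])
  moreover have "(x + M) * (x ^ Suc n + int (Suc n) * x ^ n * M) =
      x ^ Suc (Suc n) + int (Suc (Suc n)) * x ^ Suc n * M + (int (Suc n) * x ^ n) * M ^ 2"
    by (simp add: algebra_simps power2_eq_square)
  ultimately show ?case by (simp add: cong_def)
qed simp

text \<open>Voronoi's device: the residues of \<^term>\<open>2 * m\<close> for \<^term>\<open>m < M\<close> run through all residues
  modulo \<^term>\<open>M\<close>, with a carry exactly at the odd residues.\<close>

lemma power_sum_times_two_power:
  assumes "M = 2 * h + 1"
  shows "[(2 ^ Suc n - 1) * (\<Sum>m<M. int m ^ Suc n) =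
           int (Suc n) * int M * (\<Sum>t<h. int (2 * t + 1) ^ n)] (mod int M ^ 2)"
proof -
  let ?S = "\<Sum>m<M. int m ^ Suc n" and ?E = "\<Sum>t\<le>h. int (2 * t) ^ Suc n"
  have "m \<in> (\<lambda>t. h + 1 + t) ` {..<h}" if "m < M" "\<not> m \<le> h" for m
    using that assms by (intro image_eqI[of _ _ "m - (h + 1)"]) auto
  then have "{..<M} = {..h} \<union> (\<lambda>t. h + 1 + t) ` {..<h}"
    using assms by auto
  then have "(\<Sum>m<M. int (2 * m) ^ Suc n) = ?E + (\<Sum>m\<in>(\<lambda>t. h + 1 + t) ` {..<h}. int (2 * m) ^ Suc n)"
    by (simp only:, subst sum.union_disjoint) auto
  also have "(\<Sum>m\<in>(\<lambda>t. h + 1 + t) ` {..<h}. int (2 * m) ^ Suc n) =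
      (\<Sum>t<h. (int (2 * t + 1) + int M) ^ Suc n)"
  proof (subst sum.reindex, simp, rule sum.cong[OF refl])
    fix t
    have "int (2 * (h + 1 + t)) = int (2 * t + 1) + int M" by (simp add: assms)
    then show "((\<lambda>m. int (2 * m) ^ Suc n) \<circ> (\<lambda>t. h + 1 + t)) t = (int (2 * t + 1) + int M) ^ Suc n"
      by (simp only: o_apply)
  qed
  finally have "2 ^ Suc n * ?S = ?E + (\<Sum>t<h. (int (2 * t + 1) + int M) ^ Suc n)"
    by (simp add: sum_distrib_left power_mult_distrib mult_ac)
  moreover have "[(\<Sum>t<h. (int (2 * t + 1) + int M) ^ Suc n) =
      (\<Sum>t<h. int (2 * t + 1) ^ Suc n + int (Suc n) * int (2 * t + 1) ^ n * int M)] (mod int M ^ 2)"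
    by (intro cong_sum cong_power_add_square)
  moreover have "(\<Sum>t<h. int (2 * t + 1) ^ Suc n + int (Suc n) * int (2 * t + 1) ^ n * int M) =
      (\<Sum>t<h. int (2 * t + 1) ^ Suc n) + int (Suc n) * int M * (\<Sum>t<h. int (2 * t + 1) ^ n)"
    by (simp only: sum.distrib sum_distrib_left mult_ac)
  \<comment> \<open>The even part \<open>?E\<close> and the odd powers are thus replaced by
    \<open>?S\<close>, leaving only the carry term.\<close>
  moreover have "?S = ?E + (\<Sum>t<h. int (2 * t + 1) ^ Suc n)"
    unfolding assms by (rule sum_even_odd_split)
  ultimately show ?thesis
    by (simp only: cong_iff_dvd_diff left_diff_distrib mult_1_left) (simp add: algebra_simps)
qed

text \<open>The range splits into \<open>p\<close> blocks, each a complete residue system modulo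
  \<open>p\<close>, so the sum is congruent to \<open>p\<close> times a single block.\<close>

lemma dvd_power_sum_square:
  "int p dvd (\<Sum>m<p * p. int m ^ n)"
proof -
  have "(\<Sum>m<p * p. int m ^ n) = (\<Sum>a<p. \<Sum>m\<in>{a * p..<a * p + p}. int m ^ n)"
    by (rule sum.nat_group[symmetric])
  also have "\<dots> = (\<Sum>a<p. \<Sum>b<p. int (b + a * p) ^ n)"
    by (simp add: sum.shift_bounds_nat_ivl[of _ 0, simplified] atLeast0LessThan add.commute)
  also have "[\<dots> = (\<Sum>a<p. \<Sum>b<p. int b ^ n)] (mod int p)"
    by (intro cong_sum cong_pow) (simp add: cong_iff_dvd_diff)
  finally show ?thesis by (simp add: cong_dvd_iff)
qed

text \<open>In the Voronoi congruence for \<open>M = p ^ 2\<close> the left side is divisible by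
  \<open>p ^ 3 * p = M ^ 2\<close>. Cancelling \<open>M\<close> and the unit \<open>p - 1\<close>
  kills the sum over odd numbers modulo \<open>p ^ 2\<close>; the full power sum vanishes too, as
  \<open>p - 2\<close> is odd.\<close>

lemma alt_power_sum_dvd:
  assumes p: "prime p" "odd p" and w: "int p ^ 3 dvd 2 ^ (p - 1) - 1"
  shows "int p ^ 2 dvd alt_power_sum (p ^ 2) (p - 2)"
proof -
  have "p \<ge> 3" using p prime_ge_2_nat[of p] by (cases "p = 2") auto
  then have Suc: "Suc (p - 2) = p - 1" and "odd (p - 2)" using p(2) by auto
  obtain h where h: "p ^ 2 = 2 * h + 1" using p(2) by (metis oddE even_power)
  let ?S = "\<Sum>m<p ^ 2. int m ^ (p - 1)" and ?O = "\<Sum>t<h. int (2 * t + 1) ^ (p - 2)"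
  have "int p ^ 3 * int p dvd (2 ^ (p - 1) - 1) * ?S"
    using w dvd_power_sum_square[of p "p - 1"] by (intro mult_dvd_mono) (auto simp: power2_eq_square)
  then have "int (p ^ 2) ^ 2 dvd (2 ^ (p - 1) - 1) * ?S"
    by (simp add: eval_nat_numeral mult_ac)
  then have "int (p ^ 2) ^ 2 dvd int (p - 1) * int (p ^ 2) * ?O"
    using power_sum_times_two_power[OF h, of "p - 2"] unfolding Suc by (simp add: cong_dvd_iff)
  then have "int (p ^ 2) * int (p ^ 2) dvd int (p ^ 2) * (int (p - 1) * ?O)"
    by (simp only: power2_eq_square mult_ac)
  then have "int p ^ 2 dvd int (p - 1) * ?O"
    using p(1) by (simp only: dvd_mult_cancel_left) (auto dest: prime_gt_0_nat)
  moreover have "coprime (int p ^ 2) (int (p - 1))"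
    using coprime_diff_one_left_nat[of p] p(1)
    by (auto simp: coprime_commute dest: prime_gt_0_nat)
  ultimately have "int p ^ 2 dvd ?O" by (simp add: coprime_dvd_mult_right_iff)
  moreover have "int p ^ 2 dvd (\<Sum>m<p ^ 2. int m ^ (p - 2))"
    using dvd_power_sum_odd[of "p ^ 2" "p - 2"] \<open>odd (p - 2)\<close> p(2) by simp
  ultimately show ?thesis
    unfolding h alt_power_sum_odd by (intro dvd_diff dvd_mult) (simp_all add: h)
qed

section \<open>Ascent sums modulo an odd number\<close>

text \<open>Both sides satisfy the block recursion at \<open>x = -1\<close> modulo \<open>M\<close>
  and agree on the empty set.\<close>

lemma ascent_sum_cong_alt_power_sum:
  fixes A :: "'a::linorder set"
  assumes "odd M" "finite A"
  shows "[ascent_sum (-1) A = (-2) ^ card A * alt_power_sum M (card A)] (mod int M)"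
  using assms(2)
proof (induction "card A" arbitrary: A rule: less_induct)
  case less
  show ?case
  proof (cases "A = {}")
    case True
    have "alt_power_sum M 0 = 1" using alt_power_sum_recursion[OF assms(1), of 0] by simp
    then show ?thesis using True by (simp add: ascent_sum_def)
  next
    case False
    define n where "n = card A"
    have "n > 0" using False less.prems by (simp add: n_def card_gt_0_iff)
    let ?T = "alt_power_sum M"
    have "ascent_sum (-1) A = (\<Sum>B\<in>Pow A - {{}}. (-2) ^ (card B - 1) * ascent_sum (-1) (A - B) :: int)"
      using ascent_sum_recursion[OF less.prems False, of "-1 :: int"] by simp
    also have "[\<dots> = (\<Sum>B\<in>Pow A - {{}}. (-2) ^ (n - 1) * ?T (n - card B))] (mod int M)"
    proof (rule cong_sum)
      fix B assume "B \<in> Pow A - {{}}"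
      then have B: "B \<subseteq> A" "B \<noteq> {}" "finite B" using less.prems by (auto intro: finite_subset)
      then have card: "card (A - B) = n - card B" "card B > 0" "card B \<le> n"
        using less.prems by (auto simp: n_def card_Diff_subset card_gt_0_iff card_mono)
      then have "card (A - B) < card A" using \<open>n > 0\<close> by (simp add: n_def)
      then have "[ascent_sum (-1) (A - B) = (-2) ^ (n - card B) * ?T (n - card B)] (mod int M)"
        using less.hyps[of "A - B"] less.prems card(1) by simp
      then have "[(-2) ^ (card B - 1) * ascent_sum (-1) (A - B) =
          (-2) ^ (card B - 1) * ((-2) ^ (n - card B) * ?T (n - card B))] (mod int M)"
        by (rule cong_mult[OF cong_refl])
      \<comment> \<open>The powers of -2 combine to an exponent independent of \<open>B\<close>, so
        only a binomial sum of the \<open>?T\<close> remains.\<close>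
      moreover have "(-2 :: int) ^ (n - 1) = (-2) ^ (card B - 1) * (-2) ^ (n - card B)"
        using card(2,3) by (simp flip: power_add)
      ultimately show "[(-2) ^ (card B - 1) * ascent_sum (-1) (A - B) =
          (-2) ^ (n - 1) * ?T (n - card B)] (mod int M)" by (simp add: mult.assoc)
    qed
    also have "(\<Sum>B\<in>Pow A - {{}}. (-2) ^ (n - 1) * ?T (n - card B)) =
        (-2) ^ (n - 1) * ((\<Sum>B\<in>Pow A. ?T (n - card B)) - ?T n)"
      using less.prems by (simp add: sum_diff1 flip: sum_distrib_left)
    also have "(\<Sum>B\<in>Pow A. ?T (n - card B)) = (\<Sum>k\<le>n. int (n choose k) * ?T (n - k))"
      using sum_Pow_card[OF less.prems, of "\<lambda>k. ?T (n - k)"] by (simp add: n_def)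
    also have "\<dots> = int M ^ n - ?T n"
      using alt_power_sum_recursion[OF assms(1), of n] zero_power[OF \<open>n > 0\<close>, where ?'a = int]
      by linarith
    also have "[(-2) ^ (n - 1) * (int M ^ n - ?T n - ?T n) = (-2) ^ (n - 1) * (0 - ?T n - ?T n)] (mod int M)"
      using \<open>n > 0\<close> by (intro cong_mult cong_diff cong_refl) (simp add: cong_0_iff)
    \<comment> \<open>One \<open>- ?T n\<close> stems from the excluded empty block, the other from
      the telescoped recursion; together they supply the missing factor -2.\<close>
    also have "(-2) ^ (n - 1) * (0 - ?T n - ?T n) = (-2) ^ n * ?T n"
      using \<open>n > 0\<close> by (cases n) auto
    finally show ?thesis by (simp add: n_def)
  qed
qed

section \<open>The Wieferich and Wilson conditions and the digits\<close>

lemma two_times_num_even_ascents_cong_fact: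
  assumes p: "prime p" "odd p" and w: "int p ^ 3 dvd 2 ^ (p - 1) - 1"
  shows "[2 * int (num_even_ascents (p - 2)) = fact (p - 2)] (mod (int p)\<^sup>2)"
proof -
  have "[ascent_sum (-1) {1..p - 2} = (-2) ^ (p - 2) * alt_power_sum (p ^ 2) (p - 2)] (mod (int p)\<^sup>2)"
    using ascent_sum_cong_alt_power_sum[of "p ^ 2" "{1..p - 2}"] p(2) by simp
  moreover have "[(-2) ^ (p - 2) * alt_power_sum (p ^ 2) (p - 2) = 0] (mod (int p)\<^sup>2)"
    using alt_power_sum_dvd[OF assms] by (simp add: cong_0_iff)
  ultimately have "[ascent_sum (-1) {1..p - 2} = 0] (mod (int p)\<^sup>2)" by (rule cong_trans)
  then show ?thesis
    unfolding two_times_num_even_ascents using cong_add[OF cong_refl] by fastforce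
qed

text \<open>Since \<open>(p + 1) * (p - 1)\<close> is -1 modulo \<open>p ^ 2\<close>, multiplying
  Wilson's congruence by \<open>p + 1\<close> removes the factor \<open>p - 1\<close> from
  \<open>fact (p - 1)\<close>.\<close>

lemma wilson_prime_fact_cong:
  assumes "wilson_prime p" "odd p"
  shows "[fact (p - 2) = 1 + int p] (mod (int p)\<^sup>2)"
proof -
  have p: "prime p" "[fact (p - 1) = - 1 :: int] (mod (int p)\<^sup>2)"
    using assms by (simp_all add: wilson_prime_def)
  have "p \<ge> 3" using p assms(2) prime_ge_2_nat[of p] by (cases "p = 2") auto
  then have "p - 1 = Suc (p - 2)" by simp
  then have "fact (p - 1) = (int p - 1) * fact (p - 2)"
    using \<open>p \<ge> 3\<close> by (simp only: fact_Suc) (simp add: of_nat_diff)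
  then have "[(int p + 1) * ((int p - 1) * fact (p - 2)) = (int p + 1) * - 1] (mod (int p)\<^sup>2)"
    using p(2) by (simp only: cong_scalar_left)
  moreover have "(int p + 1) * ((int p - 1) * fact (p - 2)) = (int p)\<^sup>2 * fact (p - 2) - fact (p - 2)"
    by (simp add: algebra_simps power2_eq_square)
  moreover have "[(int p)\<^sup>2 * fact (p - 2) - fact (p - 2) = 0 - fact (p - 2)] (mod (int p)\<^sup>2)"
    by (intro cong_diff cong_refl) (simp add: cong_0_iff)
  ultimately have "[- fact (p - 2) = (int p + 1) * - 1] (mod (int p)\<^sup>2)"
    by (simp only: cong_def diff_0)
  moreover have "(int p + 1) * - 1 = - (1 + int p)" by simp
  ultimately show ?thesis by (simp only: cong_minus_minus_iff)
qed

text \<open>The Fermat quotient is an exact quotient by definition, so multiplying back by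
  \<open>p\<close> raises \<open>p ^ 2\<close> to \<open>p ^ 3\<close>.\<close>

lemma super_wieferich_prime_dvd:
  assumes "super_wieferich_prime p"
  shows "int p ^ 3 dvd 2 ^ (p - 1) - 1"
proof -
  have "int p * (int p)\<^sup>2 dvd int p * ((2 ^ (p - 1) - 1) div int p)"
    using assms by (intro mult_dvd_mono) (auto simp: super_wieferich_prime_def cong_0_iff)
  moreover have "int p * ((2 ^ (p - 1) - 1) div int p) = 2 ^ (p - 1) - 1"
    using assms unfolding super_wieferich_prime_def by (intro dvd_mult_div_cancel) blast
  moreover have "int p * (int p)\<^sup>2 = int p ^ 3" by (simp add: eval_nat_numeral)
  ultimately show ?thesis by (simp only:)
qed

theorem theorem14:
  fixes p :: nat
  assumes "prime p" and "odd p"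
    and "wilson_prime p" and "super_wieferich_prime p"
  shows "padic_digit p (2 * int (num_even_ascents (p - 2))) 0 = 1 \<and>
         padic_digit p (2 * int (num_even_ascents (p - 2))) 1 = 1"
proof -
  let ?x = "2 * int (num_even_ascents (p - 2))"
  have p: "p > 1" using assms(1) by (rule prime_gt_1_nat)
  have "[?x = 1 + int p] (mod (int p)\<^sup>2)"
    using two_times_num_even_ascents_cong_fact[OF assms(1,2) super_wieferich_prime_dvd[OF assms(4)]]
      wilson_prime_fact_cong[OF assms(3,2)] by (rule cong_trans)
  then obtain k where k: "?x = 1 + int p + (int p)\<^sup>2 * k"
    by (metis cong_iff_lin cong_sym)
  then have x: "?x = 1 + int p * (1 + int p * k)"
    by (simp add: algebra_simps power2_eq_square)
  \<comment> \<open>Since \<open>p > 1\<close>, the remainder 1 is digit 0, and the quotient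
    \<open>1 + int p * k\<close> again leaves remainder 1, which is digit 1.\<close>
  have "?x mod int p = 1" "?x div int p = 1 + int p * k"
    unfolding x using p by simp_all
  then show ?thesis
    using p by (simp add: padic_digit_eq)
qed

end
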